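(* Let $N, M, t$ be positive integers with $N=Mt$, let $K\ge 0$ be an integer, and let \[ \{0,1,\dots,M\}=\mathcal P_0\cup\mathcal P_1\cup\dots\cup\mathcal P_K \] be a partition into nonempty, pairwise disjoint sets. For a sequence $F=(f_1,\dots,f_M)\in\{-1,+1\}^M$, let $\psi(F)$ denote the length of the longest run of consecutive $+1$'s in $F$ (with $\psi(F)=0$ if $F$ contains no $+1$). Let $E_N=(e_1,\dots,e_N)\in\{-1,+1\}^N$. For $1\le j\le t$ write $E_N^{(j,M)}=(e_{(j-1)M+1},\dots,e_{jM})$ for the $j$-th block of $E_N$. For $0\le i\le K$ define \[ \nu_i=|\{j:\ 1\le j\le t,\ \psi(E_N^{(j,M)})\in\mathcal P_i\}|, \] and let $\pi_i$ be the probability that $\psi(G)\in\mathcal P_i$ when $G$ is chosen uniformly at random from $\{-1,+1\}^M$. Put \[ X_2=\sum_{i=0}^K\frac{(\nu_i-t\pi_i)^2}{t\pi_i}. \] Then \[ X_2\le \frac{M}{N}\left(\sum_{r=1}^M\binom{M}{r}Q_r(E_N)\right)^2 . \]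
   Context: For a sequence $E_N=(e_1,\dots,e_N)\in\{-1,+1\}^N$ and a positive integer $k$, the combined pseudorandom measure of order $k$ is \[ Q_k(E_N)=\max_{a,b,t,D}\left|\sum_{j=0}^{t}e_{a+jb+d_1}e_{a+jb+d_2}\cdots e_{a+jb+d_k}\right|, \] where the maximum is taken over all positive integers $a,b,t$ and all $k$-tuples $D=(d_1,\dots,d_k)$ of non-negative integers with $d_1<d_2<\dots<d_k$, subject to every subscript $a+jb+d_l$ occurring in the sum lying in $\{1,2,\dots,N\}$. The quantity $X_2$ is the statistic of the NIST "test for the longest run of ones in a block".
   Formalization: For k ≥ N no sum is admissible, so the maximum defining Q_k(E_N) is undefined; this arises only for a single block (t = 1, r = M = N). There Q_k is set to 1, the absolute value of the product e_1⋯e_N; with the value 0 the claim fails for N = M = t = 1. *)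

theory Defs
  imports "HOL-Probability.Probability"
begin

text \<open>
  A sequence of length \<open>n\<close> is a function on \<open>nat\<close>, of which only the values at the indices
  \<open>1, \<dots>, n\<close> matter.
\<close>

definition pm_seqs :: "nat \<Rightarrow> (nat \<Rightarrow> int) set" where
  "pm_seqs n = {1..n} \<rightarrow>\<^sub>E {-1, 1}"

definition combined_values :: "nat \<Rightarrow> (nat \<Rightarrow> int) \<Rightarrow> nat \<Rightarrow> int set" where
  "combined_values N e k =
     {\<bar>\<Sum>j = 0..t. \<Prod>l = 1..k. e (a + j * b + d l)\<bar> | a b t d.
        0 < a \<and> 0 < b \<and> 0 < t \<and> strict_mono_on {1..k} d \<and>
        (\<forall>j\<in>{0..t}. \<forall>l\<in>{1..k}. a + j * b + d l \<in> {1..N})}"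

text \<open>
  The maximum is taken over at least two summands (\<open>t > 0\<close>), so for \<open>k \<ge> N\<close> there is nothing
  to maximize over (see \<open>combined_values_empty_iff\<close> below).  We use the value \<open>1\<close> there: for
  \<open>k = N\<close> it is the absolute value of the only product that fits, \<open>e\<^sub>1 \<cdots> e\<^sub>N\<close>.
\<close>

definition combined_measure :: "nat \<Rightarrow> (nat \<Rightarrow> int) \<Rightarrow> nat \<Rightarrow> int" where
  "combined_measure N e k =
     (if combined_values N e k = {} then 1 else Max (combined_values N e k))"

definition longest_run :: "nat \<Rightarrow> (nat \<Rightarrow> int) \<Rightarrow> nat" where
  "longest_run M f = Max {l. \<exists>s. s + l \<le> M \<and> (\<forall>i\<in>{s + 1..s + l}. f i = 1)}"

definition block :: "nat \<Rightarrow> (nat \<Rightarrow> int) \<Rightarrow> nat \<Rightarrow> (nat \<Rightarrow> int)" where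
  "block M e j = (\<lambda>i. e ((j - 1) * M + i))"

definition run_count :: "nat \<Rightarrow> nat \<Rightarrow> (nat \<Rightarrow> int) \<Rightarrow> nat set \<Rightarrow> nat" where
  "run_count M t e A = card {j \<in> {1..t}. longest_run M (block M e j) \<in> A}"

definition run_prob :: "nat \<Rightarrow> nat set \<Rightarrow> real" where
  "run_prob M A = measure_pmf.prob (pmf_of_set (pm_seqs M)) {g. longest_run M g \<in> A}"

definition X2 :: "nat \<Rightarrow> nat \<Rightarrow> nat \<Rightarrow> (nat \<Rightarrow> nat set) \<Rightarrow> (nat \<Rightarrow> int) \<Rightarrow> real" where
  "X2 M t K P e =
     (\<Sum>i = 0..K. (real (run_count M t e (P i)) - real t * run_prob M (P i))\<^sup>2
                   / (real t * run_prob M (P i)))"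

lemma finite_pm_seqs: "finite (pm_seqs n)"
  and pm_seqs_nonempty: "pm_seqs n \<noteq> {}"
  by (auto simp: pm_seqs_def PiE_eq_empty_iff intro!: finite_PiE)

lemma finite_combined_values:
  assumes "0 < k" and e: "e \<in> {1..N} \<rightarrow> {-1, 1}"
  shows "finite (combined_values N e k)"
proof (rule finite_subset)
  show "combined_values N e k \<subseteq> {0..int N}"
  proof
    fix x assume "x \<in> combined_values N e k"
    then obtain a b t d where x: "x = \<bar>\<Sum>j = 0..t. \<Prod>l = 1..k. e (a + j * b + d l)\<bar>"
      and "0 < a" "0 < b"
      and ad: "\<forall>j\<in>{0..t}. \<forall>l\<in>{1..k}. a + j * b + d l \<in> {1..N}"
      unfolding combined_values_def by blast
    have "\<bar>\<Prod>l = 1..k. e (a + j * b + d l)\<bar> = 1" if "j \<in> {0..t}" for j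
    proof -
      have "\<bar>e (a + j * b + d l)\<bar> = 1" if "l \<in> {1..k}" for l
      proof -
        have "e (a + j * b + d l) \<in> {-1, 1}"
          using e ad \<open>j \<in> {0..t}\<close> that by (blast dest: funcset_mem)
        then show ?thesis by auto
      qed
      then show ?thesis by (simp add: abs_prod)
    qed
    then have "x \<le> (\<Sum>j = 0..t. 1)"
      unfolding x by (intro order_trans[OF sum_abs] sum_mono) auto
    moreover have "a + t * b + d 1 \<in> {1..N}"
      using ad \<open>0 < k\<close> by simp
    then have "a + t * b + d 1 \<le> N" by simp
    moreover have "t * 1 \<le> t * b"
      using \<open>0 < b\<close> by (intro mult_le_mono) auto
    ultimately have "t + 1 \<le> N" "x \<le> int t + 1"
      using \<open>0 < a\<close> by (linarith, simp)
    then show "x \<in> {0..int N}"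
      by (simp add: x)
  qed
qed simp

lemma combined_values_empty_iff:
  assumes "0 < k"
  shows "combined_values N e k = {} \<longleftrightarrow> N \<le> k"
proof
  assume N: "N \<le> k"
  show "combined_values N e k = {}"
  proof (rule ccontr)
    assume "combined_values N e k \<noteq> {}"
    then obtain a b t and d :: "nat \<Rightarrow> nat" where ab: "0 < a" "0 < b" "0 < t"
      and d: "strict_mono_on {1..k} d"
      and ad: "\<forall>j\<in>{0..t}. \<forall>l\<in>{1..k}. a + j * b + d l \<in> {1..N}"
      unfolding combined_values_def by blast
    have grow: "l \<le> d l + 1" if "1 \<le> l" "l \<le> k" for l
      using that
    proof (induction l rule: dec_induct)
      case (step n)
      have "d n < d (Suc n)"
        using d step by (auto simp: strict_mono_on_def)
      with step show ?case by simp
    qed simp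
    have "a + t * b + d k \<in> {1..N}"
      using ad \<open>0 < k\<close> by simp
    moreover have "1 \<le> t * b"
      using ab by simp
    moreover have "k \<le> d k + 1"
      using grow[of k] \<open>0 < k\<close> by simp
    ultimately show False
      using N ab unfolding atLeastAtMost_iff by linarith
  qed
next
  assume emp: "combined_values N e k = {}"
  show "N \<le> k"
  proof (rule ccontr)
    assume "\<not> N \<le> k"
    then have "\<forall>j\<in>{0..1}. \<forall>l\<in>{1..k}. 1 + j * 1 + (l - 1) \<in> {1..N}"
      by auto
    moreover have "strict_mono_on {1..k} (\<lambda>l. l - 1)"
      by (auto simp: strict_mono_on_def)
    ultimately have "\<bar>\<Sum>j = 0..1. \<Prod>l = 1..k. e (1 + j * 1 + (l - 1))\<bar> \<in> combined_values N e k"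
      unfolding combined_values_def mem_Collect_eq
      by (intro exI[of _ 1] exI[of _ "\<lambda>l. l - 1"] conjI) simp_all
    with emp show False by simp
  qed
qed

end

theory Submission
  imports Defs
begin

text \<open>
  By Cauchy--Schwarz, merging the \<open>2 ^ M\<close> block patterns into classes does not increase the
  chi-square statistic, so \<open>X2\<close> is at most the statistic of the full pattern counts.
  By Parseval the latter is \<open>1 / t\<close> times the sum over nonempty \<open>S \<subseteq> {1..M}\<close> of the squares
  of the correlations \<open>\<Sum>j. \<Prod>i\<in>S. e ((j - 1) * M + i)\<close>.  For \<open>t \<ge> 2\<close> these are among
  the sums defining \<open>Q\<^bsub>card S\<^esub>\<close> (with \<open>b = M\<close>).  For \<open>t = 1\<close> they consist of one summand only,
  and the combined measure is estimated from below directly.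
\<close>

lemma card_pm_seqs: "card (pm_seqs M) = 2 ^ M"
  by (simp add: pm_seqs_def card_funcsetE numeral_2_eq_2)

lemma pm_seqs_mem: "g \<in> pm_seqs M \<Longrightarrow> i \<in> {1..M} \<Longrightarrow> g i \<in> {-1, 1}"
  by (auto simp: pm_seqs_def)

subsection \<open>Coarsening and Parseval\<close>

text \<open>Orthogonality of the Walsh characters: the sum over subsets factorises into a product of
  the factors \<open>g i * h i + 1\<close>. Such a factor is 2 where the sequences agree and 0 where
  they differ.\<close>

lemma sum_prod_subsets_pm:
  assumes g: "g \<in> pm_seqs M" and h: "h \<in> pm_seqs M"
  shows "(\<Sum>S\<in>Pow {1..M}. (\<Prod>i\<in>S. g i) * (\<Prod>i\<in>S. h i)) = (if g = h then 2 ^ M else 0)"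
proof -
  have "(\<Sum>S\<in>Pow {1..M}. (\<Prod>i\<in>S. g i) * (\<Prod>i\<in>S. h i)) = (\<Prod>i\<in>{1..M}. g i * h i + 1)"
    by (simp add: prod_add prod.distrib)
  also have "\<dots> = (if g = h then 2 ^ M else 0)"
  proof (cases "g = h")
    case True
    have "(\<Prod>i\<in>{1..M}. g i * h i + 1) = (\<Prod>i\<in>{1..M}. 2)"
      using pm_seqs_mem[OF g] True by (intro prod.cong) fastforce+
    then show ?thesis using True by simp
  next
    case False
    then obtain i where i: "i \<in> {1..M}" "g i \<noteq> h i"
      using g h unfolding pm_seqs_def by (meson PiE_ext)
    then have "g i * h i + 1 = 0"
      using pm_seqs_mem[OF g] pm_seqs_mem[OF h] by fastforce
    then have "(\<Prod>i\<in>{1..M}. g i * h i + 1) = 0"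
      using i by (intro prod_zero) auto
    then show ?thesis using False by simp
  qed
  finally show ?thesis .
qed

lemma sum_card_fibres:
  assumes "finite \<Omega>" "finite J"
  shows "(\<Sum>G\<in>{G \<in> \<Omega>. R G}. card {j \<in> J. b j = G}) = card {j \<in> J. b j \<in> \<Omega> \<and> R (b j)}"
proof -
  have "(\<Sum>G\<in>{G \<in> \<Omega>. R G}. card {j \<in> J. b j = G})
      = card (\<Union>G\<in>{G \<in> \<Omega>. R G}. {j \<in> J. b j = G})"
    using assms by (subst card_UN_disjoint) auto
  also have "(\<Union>G\<in>{G \<in> \<Omega>. R G}. {j \<in> J. b j = G}) = {j \<in> J. b j \<in> \<Omega> \<and> R (b j)}"
    by auto
  finally show ?thesis .
qed

text \<open>Up to the factor \<open>2 ^ M\<close>, the squared counts and the squared correlations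
  both count the pairs of indices carrying equal patterns. Centring the counts at their uniform mean
  corresponds to dropping the empty set.\<close>

lemma pattern_parseval:
  fixes b :: "'j \<Rightarrow> nat \<Rightarrow> int"
  assumes fin: "finite J" and b: "\<And>j. j \<in> J \<Longrightarrow> b j \<in> pm_seqs M"
  shows "2 ^ M * (\<Sum>G\<in>pm_seqs M. (real (card {j \<in> J. b j = G}) - real (card J) / 2 ^ M)\<^sup>2)
       = (\<Sum>S\<in>Pow {1..M} - {{}}. (real_of_int (\<Sum>j\<in>J. \<Prod>i\<in>S. b j i))\<^sup>2)"
proof -
  define n where "n G = real (card {j \<in> J. b j = G})" for G
  define T where "T S = (\<Sum>j\<in>J. \<Prod>i\<in>S. b j i)" for S
  have n_sum: "n G = (\<Sum>j\<in>J. of_bool (b j = G))" for G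
    using fin by (simp add: n_def Int_def)
  have total: "(\<Sum>G\<in>pm_seqs M. n G) = card J"
  proof -
    have "(\<Sum>G\<in>pm_seqs M. n G) = real (\<Sum>G\<in>{G \<in> pm_seqs M. True}. card {j \<in> J. b j = G})"
      by (simp add: n_def)
    also have "\<dots> = card J"
      unfolding sum_card_fibres[OF finite_pm_seqs fin] using b
      by (intro arg_cong[of _ _ real] arg_cong[of _ _ card]) auto
    finally show ?thesis .
  qed
  \<comment> \<open>The second moment of the counts is the number of ordered pairs
    \<open>(j, k)\<close> with \<open>b j = b k\<close>.\<close>
  have "(\<Sum>G\<in>pm_seqs M. (n G)\<^sup>2) = (\<Sum>G\<in>pm_seqs M. \<Sum>j\<in>J. of_bool (b j = G) * n G)"
    by (simp add: power2_eq_square n_sum sum_distrib_right)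
  also have "\<dots> = (\<Sum>j\<in>J. \<Sum>G\<in>pm_seqs M. of_bool (b j = G) * n G)"
    by (rule sum.swap)
  also have "\<dots> = (\<Sum>j\<in>J. n (b j))"
  proof (intro sum.cong refl)
    fix j assume "j \<in> J"
    then show "(\<Sum>G\<in>pm_seqs M. of_bool (b j = G) * n G) = n (b j)"
      using b finite_pm_seqs[of M]
      by (simp add: of_bool_def if_distrib[of "\<lambda>x. x * _"] cong: if_cong)
  qed
  also have "\<dots> = (\<Sum>j\<in>J. \<Sum>k\<in>J. of_bool (b j = b k))"
    by (simp only: n_sum eq_commute)
  finally have squares: "(\<Sum>G\<in>pm_seqs M. (n G)\<^sup>2) = (\<Sum>j\<in>J. \<Sum>k\<in>J. of_bool (b j = b k))" .

  have "(\<Sum>S\<in>Pow {1..M}. (T S)\<^sup>2)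
      = (\<Sum>S\<in>Pow {1..M}. \<Sum>j\<in>J. \<Sum>k\<in>J. (\<Prod>i\<in>S. b j i) * (\<Prod>i\<in>S. b k i))"
    by (simp add: T_def power2_eq_square sum_product)
  also have "\<dots> = (\<Sum>j\<in>J. \<Sum>S\<in>Pow {1..M}. \<Sum>k\<in>J. (\<Prod>i\<in>S. b j i) * (\<Prod>i\<in>S. b k i))"
    by (rule sum.swap)
  also have "\<dots> = (\<Sum>j\<in>J. \<Sum>k\<in>J. \<Sum>S\<in>Pow {1..M}. (\<Prod>i\<in>S. b j i) * (\<Prod>i\<in>S. b k i))"
    by (intro sum.cong refl sum.swap)
  also have "\<dots> = (\<Sum>j\<in>J. \<Sum>k\<in>J. 2 ^ M * of_bool (b j = b k))"
    using b by (intro sum.cong refl, subst sum_prod_subsets_pm) auto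
  finally have "real_of_int (\<Sum>S\<in>Pow {1..M}. (T S)\<^sup>2)
      = of_int (\<Sum>j\<in>J. \<Sum>k\<in>J. 2 ^ M * of_bool (b j = b k))"
    by simp
  then have "(\<Sum>S\<in>Pow {1..M}. (real_of_int (T S))\<^sup>2)
      = 2 ^ M * (\<Sum>j\<in>J. \<Sum>k\<in>J. of_bool (b j = b k))"
    by (simp add: sum_distrib_left del: sum_mult_of_bool_eq sum_of_bool_mult_eq sum_of_bool_eq)
  \<comment> \<open>The empty product is 1, so \<open>T {} = card J\<close>; this term will cancel
    against the one produced by centring.\<close>
  moreover have "(\<Sum>S\<in>Pow {1..M}. (real_of_int (T S))\<^sup>2)
      = (\<Sum>S\<in>Pow {1..M} - {{}}. (real_of_int (T S))\<^sup>2) + (real (card J))\<^sup>2"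
    by (subst sum.remove[of _ "{}"]) (auto simp: T_def)
  ultimately have T: "2 ^ M * (\<Sum>G\<in>pm_seqs M. (n G)\<^sup>2)
      = (\<Sum>S\<in>Pow {1..M} - {{}}. (real_of_int (T S))\<^sup>2) + (real (card J))\<^sup>2"
    using squares by simp

  have "(\<Sum>G\<in>pm_seqs M. (n G - real (card J) / 2 ^ M)\<^sup>2)
      = (\<Sum>G\<in>pm_seqs M. (n G)\<^sup>2) - 2 * (real (card J) / 2 ^ M) * (\<Sum>G\<in>pm_seqs M. n G)
        + card (pm_seqs M) * (real (card J) / 2 ^ M)\<^sup>2"
    by (simp add: power2_diff sum.distrib sum_subtractf sum_distrib_left sum_divide_distrib mult_ac)
  also have "\<dots> = (\<Sum>G\<in>pm_seqs M. (n G)\<^sup>2) - (real (card J))\<^sup>2 / 2 ^ M"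
    by (simp add: total card_pm_seqs power2_eq_square)
  finally have "2 ^ M * (\<Sum>G\<in>pm_seqs M. (n G - real (card J) / 2 ^ M)\<^sup>2)
      = 2 ^ M * (\<Sum>G\<in>pm_seqs M. (n G)\<^sup>2) - (real (card J))\<^sup>2"
    by (simp add: right_diff_distrib)
  then show ?thesis
    using T by (simp add: n_def T_def)
qed

text \<open>Cells with \<open>card (A i) = 0\<close> contribute \<open>0\<close> on the left because \<open>x / 0 = 0\<close>.\<close>

lemma chi_square_coarsen:
  fixes c :: "'a \<Rightarrow> real"
  assumes fin: "finite \<Omega>" "finite I" and sub: "\<And>i. i \<in> I \<Longrightarrow> A i \<subseteq> \<Omega>"
    and disj: "disjoint_family_on A I" and q: "q > 0"
  shows "(\<Sum>i\<in>I. (\<Sum>G\<in>A i. c G)\<^sup>2 / (q * real (card (A i)))) \<le> (\<Sum>G\<in>\<Omega>. (c G)\<^sup>2) / q"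
proof -
  have finA: "finite (A i)" if "i \<in> I" for i
    using sub[OF that] fin(1) by (rule finite_subset)
  have "(\<Sum>i\<in>I. (\<Sum>G\<in>A i. c G)\<^sup>2 / (q * real (card (A i)))) \<le> (\<Sum>i\<in>I. (\<Sum>G\<in>A i. (c G)\<^sup>2) / q)"
  proof (intro sum_mono)
    fix i assume i: "i \<in> I"
    show "(\<Sum>G\<in>A i. c G)\<^sup>2 / (q * real (card (A i))) \<le> (\<Sum>G\<in>A i. (c G)\<^sup>2) / q"
    proof (cases "card (A i) = 0")
      case True
      then show ?thesis using q by (simp add: sum_nonneg)
    next
      case False
      have "(\<Sum>G\<in>A i. c G)\<^sup>2 \<le> (\<Sum>G\<in>A i. (c G)\<^sup>2) * real (card (A i))"
        by (rule sum_squared_le_sum_of_squares)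
      then show ?thesis
        using False q by (simp add: field_simps)
    qed
  qed
  also have "\<dots> = (\<Sum>G\<in>(\<Union>i\<in>I. A i). (c G)\<^sup>2) / q"
    using disj finA fin
    by (subst sum.UNION_disjoint) (auto simp: disjoint_family_on_def sum_divide_distrib)
  also have "\<dots> \<le> (\<Sum>G\<in>\<Omega>. (c G)\<^sup>2) / q"
    using fin sub q by (intro divide_right_mono sum_mono2) auto
  finally show ?thesis .
qed

section \<open>Longest runs and the pattern counts of blocks\<close>

lemma longest_run_cong:
  assumes "\<And>i. i \<in> {1..M} \<Longrightarrow> f i = g i"
  shows "longest_run M f = longest_run M g"
proof -
  have "(\<forall>i\<in>{s + 1..s + l}. f i = 1) \<longleftrightarrow> (\<forall>i\<in>{s + 1..s + l}. g i = 1)" if "s + l \<le> M" for s l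
    using that assms by (intro ball_cong) auto
  then show ?thesis
    unfolding longest_run_def by (intro arg_cong[of _ _ Max] Collect_cong) blast
qed

lemma longest_run_le: "longest_run M f \<le> M"
proof -
  have "finite {l. \<exists>s. s + l \<le> M \<and> (\<forall>i\<in>{s + 1..s + l}. f i = 1)}"
    by (rule finite_subset[of _ "{..M}"]) auto
  moreover have "0 \<in> {l. \<exists>s. s + l \<le> M \<and> (\<forall>i\<in>{s + 1..s + l}. f i = 1)}"
    by auto
  ultimately show ?thesis
    unfolding longest_run_def by (intro Max.boundedI) (blast, blast, auto)
qed

text \<open>Serves the exceptional case \<open>M = 2\<close> of a single block: the two sequences
  with unequal entries have the same longest run, so no partition can separate them.\<close>

lemma longest_run_2:
  assumes "f 1 \<noteq> f 2" and "f 1 = 1 \<or> f 2 = 1"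
  shows "longest_run 2 f = 1"
  unfolding longest_run_def
proof (rule Max_eqI)
  show "finite {l. \<exists>s. s + l \<le> 2 \<and> (\<forall>i\<in>{s + 1..s + l}. f i = 1)}"
    by (rule finite_subset[of _ "{..2}"]) auto
next
  fix l assume "l \<in> {l. \<exists>s. s + l \<le> 2 \<and> (\<forall>i\<in>{s + 1..s + l}. f i = 1)}"
  then obtain s where s: "s + l \<le> 2" "\<forall>i\<in>{s + 1..s + l}. f i = 1"
    by auto
  show "l \<le> 1"
  proof (rule ccontr)
    assume "\<not> l \<le> 1"
    then have "s = 0" "l = 2" using s by auto
    then have "f 1 = 1" "f 2 = 1" using s(2) by auto
    then show False using assms by simp
  qed
next
  show "1 \<in> {l. \<exists>s. s + l \<le> 2 \<and> (\<forall>i\<in>{s + 1..s + l}. f i = 1)}"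
    using assms(2)
  proof
    assume "f 1 = 1"
    then show ?thesis by (auto intro!: exI[of _ 0])
  next
    assume "f 2 = 1"
    then show ?thesis by (auto intro!: exI[of _ 1] simp: numeral_2_eq_2)
  qed
qed

definition run_class :: "nat \<Rightarrow> nat set \<Rightarrow> (nat \<Rightarrow> int) set" where
  "run_class M A = {G \<in> pm_seqs M. longest_run M G \<in> A}"

lemma finite_run_class: "finite (run_class M A)"
  by (simp add: run_class_def finite_pm_seqs)

lemma run_prob_eq: "run_prob M A = real (card (run_class M A)) / 2 ^ M"
  unfolding run_prob_def run_class_def
  by (subst measure_pmf_of_set[OF pm_seqs_nonempty finite_pm_seqs]) (simp add: card_pm_seqs Int_def)

lemma disjoint_run_class:
  "disjoint_family_on P I \<Longrightarrow> disjoint_family_on (\<lambda>i. run_class M (P i)) I"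
  unfolding disjoint_family_on_def run_class_def by blast

text \<open>\<open>block\<close> is a shifted function on all of \<open>nat\<close>. Restricting it
  makes it extensional, so that blocks with the same entries become the same element of
  \<open>pm_seqs M\<close>.\<close>

lemma block_pattern:
  assumes "e \<in> {1..M * t} \<rightarrow> {-1, 1}" "j \<in> {1..t}"
  shows "restrict (block M e j) {1..M} \<in> pm_seqs M"
proof -
  have "(j - 1) * M + i \<in> {1..M * t}" if "i \<in> {1..M}" for i
  proof -
    obtain k where k: "j = Suc k" "k < t"
      using assms(2) by (cases j) auto
    have "k * M + i \<le> Suc k * M" using that by simp
    also have "\<dots> \<le> t * M" using k by (intro mult_le_mono) auto
    finally show ?thesis using that k by (simp add: mult.commute)
  qed
  then show ?thesis
    using assms(1) unfolding pm_seqs_def block_def by (auto simp: Pi_iff)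
qed

lemma run_count_eq:
  assumes "e \<in> {1..M * t} \<rightarrow> {-1, 1}"
  shows "run_count M t e A
       = (\<Sum>G\<in>run_class M A. card {j \<in> {1..t}. restrict (block M e j) {1..M} = G})"
proof -
  have "longest_run M (restrict (block M e j) {1..M}) = longest_run M (block M e j)" for j
    by (rule longest_run_cong) simp
  then show ?thesis
    unfolding run_class_def sum_card_fibres[OF finite_pm_seqs finite_atLeastAtMost] run_count_def
    using block_pattern[OF assms]
    by (intro arg_cong[of _ _ card]) auto
qed

text \<open>On each class the deviation of the run count is the sum of the deviations
  \<open>c G\<close> of its patterns. Coarsening applies with the expected pattern count
  \<open>t / 2 ^ M\<close> as \<open>q\<close>, and Parseval evaluates the resulting sum of
  squares.\<close>

lemma X2_le_sum_correlations:
  assumes e: "e \<in> {1..M * t} \<rightarrow> {-1, 1}" and t: "0 < t"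
    and disj: "disjoint_family_on P {0..K}"
  shows "X2 M t K P e
     \<le> (\<Sum>S\<in>Pow {1..M} - {{}}. (real_of_int (\<Sum>j = 1..t. \<Prod>i\<in>S. block M e j i))\<^sup>2) / real t"
proof -
  define b where "b j = restrict (block M e j) {1..M}" for j
  define c where "c G = real (card {j \<in> {1..t}. b j = G}) - real t / 2 ^ M" for G
  have b: "b j \<in> pm_seqs M" if "j \<in> {1..t}" for j
    unfolding b_def by (rule block_pattern[OF e that])
  have "real (run_count M t e A) - real t * run_prob M A = (\<Sum>G\<in>run_class M A. c G)" for A
    by (simp add: run_count_eq[OF e] run_prob_eq c_def b_def sum_subtractf mult.commute)
  then have "X2 M t K P e = (\<Sum>i = 0..K. (\<Sum>G\<in>run_class M (P i). c G)\<^sup>2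
                   / (real t / 2 ^ M * card (run_class M (P i))))"
    by (simp add: X2_def run_prob_eq)
  also have "\<dots> \<le> (\<Sum>G\<in>pm_seqs M. (c G)\<^sup>2) / (real t / 2 ^ M)"
    using t by (intro chi_square_coarsen disjoint_run_class disj)
      (auto simp: finite_pm_seqs run_class_def)
  also have "\<dots> = 2 ^ M * (\<Sum>G\<in>pm_seqs M. (c G)\<^sup>2) / real t"
    by simp
  also have "2 ^ M * (\<Sum>G\<in>pm_seqs M. (c G)\<^sup>2)
      = (\<Sum>S\<in>Pow {1..M} - {{}}. (real_of_int (\<Sum>j = 1..t. \<Prod>i\<in>S. b j i))\<^sup>2)"
    using pattern_parseval[of "{1..t}" b M] b by (simp add: c_def)
  also have "\<dots> = (\<Sum>S\<in>Pow {1..M} - {{}}. (real_of_int (\<Sum>j = 1..t. \<Prod>i\<in>S. block M e j i))\<^sup>2)"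
  proof (intro sum.cong refl)
    fix S assume "S \<in> Pow {1..M} - {{}}"
    then have "(\<Prod>i\<in>S. b j i) = (\<Prod>i\<in>S. block M e j i)" for j
      unfolding b_def by (intro prod.cong) auto
    then show "(real_of_int (\<Sum>j = 1..t. \<Prod>i\<in>S. b j i))\<^sup>2
        = (real_of_int (\<Sum>j = 1..t. \<Prod>i\<in>S. block M e j i))\<^sup>2" by simp
  qed
  finally show ?thesis .
qed

subsection \<open>Lower bounds for the combined measure\<close>

text \<open>Lets a finite set \<open>D\<close> play the role of the increasing tuple:
  \<open>d\<close> is its increasing enumeration, moved from base 0 to base 1.\<close>

lemma combined_measure_ge:
  assumes e: "e \<in> {1..N} \<rightarrow> {-1, 1}" and D: "finite D" "D \<noteq> {}"
    and pos: "0 < a" "0 < b" "0 < t"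
    and bd: "\<And>x. x \<in> D \<Longrightarrow> a + t * b + x \<le> N"
  shows "\<bar>\<Sum>j = 0..t. \<Prod>x\<in>D. e (a + j * b + x)\<bar> \<le> combined_measure N e (card D)"
proof -
  obtain h where h: "bij_betw h {..<card D} D" "strict_mono_on {..<card D} h"
    using ex_bij_betw_strict_mono_card[OF D(1)] by blast
  define d where "d l = h (l - 1)" for l
  have "bij_betw (\<lambda>l. l - 1) {1..card D} {..<card D}"
    by (rule bij_betw_byWitness[of _ Suc]) auto
  then have bij: "bij_betw d {1..card D} D"
    using bij_betw_trans[OF _ h(1)] by (simp add: d_def[abs_def] comp_def)
  have mono: "strict_mono_on {1..card D} d"
    unfolding d_def by (rule strict_mono_onI) (auto intro!: strict_mono_onD[OF h(2)])
  have "\<forall>j\<in>{0..t}. \<forall>l\<in>{1..card D}. a + j * b + d l \<in> {1..N}"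
  proof (intro ballI)
    fix j l assume jl: "j \<in> {0..t}" "l \<in> {1..card D}"
    have "d l \<in> D" using bij jl(2) by (rule bij_betw_apply)
    then have "a + t * b + d l \<le> N" by (rule bd)
    \<comment> \<open>The subscripts grow with \<open>j\<close>, so the bound assumed for the last
      summand covers all of them.\<close>
    moreover have "j * b \<le> t * b" using jl by (intro mult_le_mono1) simp
    ultimately show "a + j * b + d l \<in> {1..N}" using pos unfolding atLeastAtMost_iff by linarith
  qed
  then have "\<bar>\<Sum>j = 0..t. \<Prod>l = 1..card D. e (a + j * b + d l)\<bar> \<in> combined_values N e (card D)"
    unfolding combined_values_def mem_Collect_eq using pos mono
    by (intro exI[of _ a] exI[of _ b] exI[of _ t] exI[of _ d]) simp
  also have "(\<Sum>j = 0..t. \<Prod>l = 1..card D. e (a + j * b + d l))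
      = (\<Sum>j = 0..t. \<Prod>x\<in>D. e (a + j * b + x))"
    by (intro sum.cong refl prod.reindex_bij_betw[OF bij])
  finally have mem: "\<bar>\<Sum>j = 0..t. \<Prod>x\<in>D. e (a + j * b + x)\<bar> \<in> combined_values N e (card D)" .
  moreover have "finite (combined_values N e (card D))"
    using D e by (intro finite_combined_values) (auto simp: card_gt_0_iff)
  ultimately show ?thesis
    unfolding combined_measure_def by auto
qed

lemma combined_measure_nonneg:
  assumes e: "e \<in> {1..N} \<rightarrow> {-1, 1}" and "0 < k"
  shows "0 \<le> combined_measure N e k"
proof (cases "combined_values N e k = {}")
  case False
  have "Max (combined_values N e k) \<in> combined_values N e k"
    using finite_combined_values[OF assms(2) e] False by (rule Max_in)
  then show ?thesis
    by (auto simp: combined_measure_def combined_values_def)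
qed (simp add: combined_measure_def)

text \<open>Among the products over three translates of a window of length \<open>k\<close>, two are equal.\<close>

lemma combined_measure_ge_2:
  assumes e: "e \<in> {1..N} \<rightarrow> {-1, 1}" and k: "0 < k" "k + 2 \<le> N"
  shows "2 \<le> combined_measure N e k"
proof -
  define p where "p a = (\<Prod>x\<in>{0..<k}. e (a + x))" for a
  \<comment> \<open>The window starting at 3 ends at \<open>k + 2\<close>, hence still within the
    sequence.\<close>
  have p: "\<bar>p a\<bar> = 1" if "0 < a" "a \<le> 3" for a
  proof -
    have "\<bar>e (a + x)\<bar> = 1" if "x \<in> {0..<k}" for x
    proof -
      have "e (a + x) \<in> {-1, 1}"
        using \<open>0 < a\<close> \<open>a \<le> 3\<close> that k by (intro funcset_mem[OF e]) auto
      then show ?thesis by auto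
    qed
    then show ?thesis by (simp add: p_def abs_prod)
  qed
  have pair: "\<bar>p a + p a'\<bar> \<le> combined_measure N e k" if "0 < a" "a < a'" "a' \<le> 3" for a a'
  proof -
    have "\<bar>\<Sum>j = 0..1. \<Prod>x\<in>{0..<k}. e (a + j * (a' - a) + x)\<bar>
        \<le> combined_measure N e (card {0..<k})"
      using that k by (intro combined_measure_ge[OF e]) auto
    then show ?thesis using that by (simp add: p_def)
  qed
  have "p 1 = p 2 \<or> p 1 = p 3 \<or> p 2 = p 3"
    using p[of 1] p[of 2] p[of 3] by linarith
  then obtain a a' where aa: "0 < a" "a < a'" "a' \<le> 3" "p a = p a'"
    by (elim disjE) (rule that[of 1 2] that[of 1 3] that[of 2 3]; simp)+
  then show ?thesis
    using pair[OF aa(1-3)] p[of a] by linarith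
qed

text \<open>The two-term sum \<open>e 1 + e 2\<close> already has absolute value 2. This replaces
  the argument with three windows when \<open>N = 2\<close>, where three do not fit.\<close>

lemma combined_measure_1_ge_2:
  assumes e: "e \<in> {1..N} \<rightarrow> {-1, 1}" and "2 \<le> N" "e 1 = e 2"
  shows "2 \<le> combined_measure N e 1"
proof -
  have "\<bar>\<Sum>j = 0..1. \<Prod>x\<in>{0}. e (1 + j * 1 + x)\<bar> \<le> combined_measure N e (card {0::nat})"
    using assms by (intro combined_measure_ge[OF e]) auto
  moreover have "e 2 \<in> {-1, 1}"
    using assms by (intro funcset_mem[OF e]) auto
  ultimately show ?thesis
    using assms(3) by (auto simp: numeral_2_eq_2)
qed

text \<open>Two summands need more room than \<open>N\<close> subscripts offer, so this is the
  default value of the measure over an empty set of sums.\<close>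

lemma combined_measure_self:
  assumes "0 < N"
  shows "combined_measure N e N = 1"
  using assms by (simp add: combined_measure_def combined_values_empty_iff)

text \<open>The correlation is an admissible sum with start 1, step \<open>M\<close> and shifts
  \<open>i - 1\<close> for \<open>i\<close> in \<open>S\<close>. Counting blocks from 0, the last
  one has index \<open>t - 1\<close>, and this must be positive: hence
  \<open>2 \<le> t\<close>.\<close>

lemma block_correlation_le:
  assumes e: "e \<in> {1..M * t} \<rightarrow> {-1, 1}" and t: "2 \<le> t"
    and S: "S \<subseteq> {1..M}" "S \<noteq> {}"
  shows "\<bar>\<Sum>j = 1..t. \<Prod>i\<in>S. block M e j i\<bar> \<le> combined_measure (M * t) e (card S)"
proof -
  obtain u where u: "t = Suc u" "0 < u"
    using t by (cases t) auto
  define D where "D = (\<lambda>i. i - 1) ` S"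
  have inj: "inj_on (\<lambda>i. i - 1) S"
  proof (rule inj_onI)
    fix x y assume "x \<in> S" "y \<in> S" "x - 1 = y - 1"
    moreover from this have "1 \<le> x" "1 \<le> y" using S by auto
    ultimately show "x = y" by simp
  qed
  have M: "0 < M" using S by auto
  have "finite S" using S finite_subset by blast
  have "(\<Sum>j = 1..t. \<Prod>i\<in>S. block M e j i) = (\<Sum>j = 0..u. \<Prod>i\<in>S. block M e (Suc j) i)"
    unfolding u One_nat_def by (rule sum.atLeast_Suc_atMost_Suc_shift[unfolded comp_def])
  also have "\<dots> = (\<Sum>j = 0..u. \<Prod>x\<in>D. e (1 + j * M + x))"
  proof (intro sum.cong refl)
    fix j
    have "(\<Prod>x\<in>D. e (1 + j * M + x)) = (\<Prod>i\<in>S. e (1 + j * M + (i - 1)))"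
      unfolding D_def by (subst prod.reindex[OF inj]) simp
    also have "\<dots> = (\<Prod>i\<in>S. block M e (Suc j) i)"
      using S by (intro prod.cong refl) (force simp: block_def)
    finally show "(\<Prod>i\<in>S. block M e (Suc j) i) = (\<Prod>x\<in>D. e (1 + j * M + x))" ..
  qed
  also have "\<bar>\<dots>\<bar> \<le> combined_measure (M * t) e (card D)"
  proof (rule combined_measure_ge[OF e])
    fix x assume "x \<in> D"
    then have "x < M" using S unfolding D_def by force
    then show "1 + u * M + x \<le> M * t"
      by (simp add: u)
  qed (use S u M \<open>finite S\<close> in \<open>auto simp: D_def\<close>)
  also have "card D = card S"
    unfolding D_def by (rule card_image[OF inj])
  finally show ?thesis .
qed

section \<open>From correlations to the bound for at least two blocks\<close>

lemma sum_nonempty_subsets_card: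
  fixes f :: "nat \<Rightarrow> real"
  shows "(\<Sum>S\<in>Pow {1..M} - {{}}. f (card S)) = (\<Sum>r = 1..M. real (M choose r) * f r)"
proof -
  have "(\<Sum>S\<in>Pow {1..M} - {{}}. f (card S))
      = (\<Sum>r = 1..M. \<Sum>S\<in>{S \<in> Pow {1..M} - {{}}. card S = r}. f (card S))"
  proof (rule sum.group[symmetric])
    show "card ` (Pow {1..M} - {{}}) \<subseteq> {1..M}"
    proof
      fix r assume "r \<in> card ` (Pow {1..M} - {{}})"
      then obtain S where S: "S \<subseteq> {1..M}" "S \<noteq> {}" "r = card S" by auto
      then have "finite S" "card S \<le> card {1..M}"
        using finite_subset card_mono[OF finite_atLeastAtMost S(1)] by auto
      then show "r \<in> {1..M}" using S by (simp add: Suc_le_eq card_gt_0_iff)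
    qed
  qed auto
  also have "\<dots> = (\<Sum>r = 1..M. real (M choose r) * f r)"
  proof (intro sum.cong refl)
    fix r assume r: "r \<in> {1..M}"
    have "{S \<in> Pow {1..M} - {{}}. card S = r} = {S. S \<subseteq> {1..M} \<and> card S = r}"
      using r by auto
    then show "(\<Sum>S\<in>{S \<in> Pow {1..M} - {{}}. card S = r}. f (card S)) = real (M choose r) * f r"
      using n_subsets[of "{1..M}" r] by simp
  qed
  finally show ?thesis .
qed

text \<open>The Euclidean norm is at most the sum norm.\<close>

lemma sum_power2_le_power2_sum:
  fixes f :: "'a \<Rightarrow> real"
  assumes "\<And>x. x \<in> A \<Longrightarrow> 0 \<le> f x"
  shows "(\<Sum>x\<in>A. (f x)\<^sup>2) \<le> (\<Sum>x\<in>A. f x)\<^sup>2"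
proof -
  have "(L2_set f A)\<^sup>2 \<le> (\<Sum>x\<in>A. f x)\<^sup>2"
    using assms by (intro power_mono L2_set_le_sum) auto
  then show ?thesis
    by (simp add: L2_set_def sum_nonneg)
qed

text \<open>Each correlation is replaced by the measure of order \<open>card S\<close>, the sum of
  squares by the square of the sum, and the subsets are then grouped by size.\<close>

lemma X2_le_of_two_blocks:
  assumes e: "e \<in> {1..M * t} \<rightarrow> {-1, 1}" and t: "2 \<le> t"
    and disj: "disjoint_family_on P {0..K}"
  shows "X2 M t K P e
     \<le> (\<Sum>r = 1..M. real (M choose r) * real_of_int (combined_measure (M * t) e r))\<^sup>2 / real t"
proof -
  define q where "q S = real_of_int (combined_measure (M * t) e (card S))" for S :: "nat set"
  have corr: "\<bar>real_of_int (\<Sum>j = 1..t. \<Prod>i\<in>S. block M e j i)\<bar> \<le> q S"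
    if "S \<in> Pow {1..M} - {{}}" for S
    using block_correlation_le[OF e t, of S] that unfolding q_def
    by (simp del: of_int_sum of_int_prod flip: of_int_abs)
  have "X2 M t K P e
     \<le> (\<Sum>S\<in>Pow {1..M} - {{}}. (real_of_int (\<Sum>j = 1..t. \<Prod>i\<in>S. block M e j i))\<^sup>2) / real t"
    using t by (intro X2_le_sum_correlations[OF e _ disj]) simp
  also have "\<dots> \<le> (\<Sum>S\<in>Pow {1..M} - {{}}. (q S)\<^sup>2) / real t"
    using corr by (intro divide_right_mono sum_mono)
      (auto intro: abs_le_square_iff[THEN iffD1, OF order_trans[OF _ abs_ge_self]])
  also have "\<dots> \<le> (\<Sum>S\<in>Pow {1..M} - {{}}. q S)\<^sup>2 / real t"
    using corr by (intro divide_right_mono sum_power2_le_power2_sum)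
      (auto intro: order_trans[OF abs_ge_zero])
  also have "(\<Sum>S\<in>Pow {1..M} - {{}}. q S)
      = (\<Sum>r = 1..M. real (M choose r) * real_of_int (combined_measure (M * t) e r))"
    unfolding q_def by (rule sum_nonempty_subsets_card)
  finally show ?thesis .
qed

subsection \<open>A single block\<close>

text \<open>For a single observation falling into cell \<open>i\<^sub>0\<close>, every other cell
  contributes \<open>p i\<close>, also when \<open>p i = 0\<close>, since \<open>0 / 0 = 0\<close>.
  The cell itself contributes \<open>1 / p i\<^sub>0 - 2 + p i\<^sub>0\<close>.\<close>

lemma chi_square_single:
  fixes p :: "'a \<Rightarrow> real"
  assumes fin: "finite I" and i0: "i\<^sub>0 \<in> I" "p i\<^sub>0 \<noteq> 0" and sum1: "(\<Sum>i\<in>I. p i) = 1"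
  shows "(\<Sum>i\<in>I. (of_bool (i = i\<^sub>0) - p i)\<^sup>2 / p i) = 1 / p i\<^sub>0 - 1"
proof -
  have "(\<Sum>i\<in>I. (of_bool (i = i\<^sub>0) - p i)\<^sup>2 / p i)
      = (\<Sum>i\<in>I. (if i = i\<^sub>0 then 1 / p i\<^sub>0 - 2 else 0) + p i)"
    using i0 by (intro sum.cong refl) (auto simp: power2_eq_square field_simps)
  also have "\<dots> = 1 / p i\<^sub>0 - 1"
    using fin i0 sum1 by (simp add: sum.distrib)
  finally show ?thesis .
qed

text \<open>The statistic is \<open>1 / p - 1\<close>, where \<open>p\<close> is the probability of
  the class containing the longest run of \<open>e\<close>. All of \<open>C\<close> lies in that
  class, so \<open>p\<close> is at least \<open>card C / 2 ^ M\<close>.\<close>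

lemma X2_one_block:
  assumes e: "e \<in> {1..M} \<rightarrow> {-1, 1}"
    and cover: "(\<Union>i\<in>{0..K}. P i) = {0..M}" and disj: "disjoint_family_on P {0..K}"
    and c: "finite C" "C \<noteq> {}" "C \<subseteq> {G \<in> pm_seqs M. longest_run M G = longest_run M e}"
  shows "X2 M 1 K P e \<le> 2 ^ M / card C - 1"
proof -
  have "longest_run M e \<in> (\<Union>i\<in>{0..K}. P i)"
    unfolding cover by (simp add: longest_run_le)
  then obtain i0 where i0: "i0 \<in> {0..K}" "longest_run M e \<in> P i0"
    by blast
  have "C \<subseteq> run_class M (P i0)"
    using c(3) i0 by (auto simp: run_class_def)
  then have le: "card C \<le> card (run_class M (P i0))"
    by (rule card_mono[OF finite_run_class])
  have C: "0 < card C" using c by (simp add: card_gt_0_iff)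
  have "block M e 1 = e" by (simp add: block_def)
  then have count: "run_count M 1 e A = of_bool (longest_run M e \<in> A)" for A
    by (cases "longest_run M e \<in> A") (auto simp: run_count_def card_1_singleton_iff)
  have count_i: "run_count M 1 e (P i) = of_bool (i = i0)" if "i \<in> {0..K}" for i
    using disjoint_family_onD[OF disj that i0(1)] i0(2) by (auto simp: count[unfolded One_nat_def])
  have "(\<Sum>i\<in>{0..K}. card (run_class M (P i))) = card (\<Union>i\<in>{0..K}. run_class M (P i))"
    using disjoint_run_class[OF disj] finite_run_class
    by (subst card_UN_disjoint) (auto simp: disjoint_family_on_def)
  also have "(\<Union>i\<in>{0..K}. run_class M (P i)) = pm_seqs M"
  proof -
    have "longest_run M G \<in> (\<Union>i\<in>{0..K}. P i)" for G
      unfolding cover by (simp add: longest_run_le)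
    then show ?thesis unfolding run_class_def by blast
  qed
  finally have "(\<Sum>i\<in>{0..K}. run_prob M (P i)) = 1"
    by (simp add: run_prob_eq card_pm_seqs flip: sum_divide_distrib of_nat_sum)
  then have "(\<Sum>i\<in>{0..K}. (of_bool (i = i0) - run_prob M (P i))\<^sup>2 / run_prob M (P i))
      = 1 / run_prob M (P i0) - 1"
    using i0 C le by (intro chi_square_single) (auto simp: run_prob_eq)
  moreover have "X2 M 1 K P e
      = (\<Sum>i\<in>{0..K}. (of_bool (i = i0) - run_prob M (P i))\<^sup>2 / run_prob M (P i))"
    unfolding X2_def by (intro sum.cong refl) (simp only: count_i of_nat_1 of_nat_of_bool mult_1)
  ultimately have "X2 M 1 K P e = 2 ^ M / card (run_class M (P i0)) - 1"
    by (simp add: run_prob_eq)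
  also have "\<dots> \<le> 2 ^ M / card C - 1"
    using C le by (simp add: frac_le)
  finally show ?thesis .
qed

text \<open>The orders up to \<open>M - 2\<close> carry binomial weight \<open>2 ^ M - M - 2\<close>
  and count at least twice, which makes up for a possible zero at order \<open>M - 1\<close>. At
  \<open>M = 3\<close> the estimate is tight.\<close>

lemma sum_choose_ge:
  fixes q :: "nat \<Rightarrow> real"
  assumes M: "3 \<le> M" and q: "\<And>r. 1 \<le> r \<Longrightarrow> r + 2 \<le> M \<Longrightarrow> 2 \<le> q r"
    and q0: "0 \<le> q (M - 1)" and qM: "1 \<le> q M"
  shows "2 ^ M - 1 \<le> (\<Sum>r = 1..M. real (M choose r) * q r)"
proof -
  obtain m where m: "M = Suc (Suc m)" "1 \<le> m"
    using M by (intro that[of "M - 2"]) auto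
  define A where "A = (\<Sum>r = 1..m. real (M choose r))"
  have "(\<Sum>r\<le>M. real (M choose r)) = 2 ^ M"
    by (metis choose_row_sum of_nat_numeral of_nat_power of_nat_sum)
  also have "(\<Sum>r\<le>M. real (M choose r)) = 1 + (\<Sum>r = 1..M. real (M choose r))"
    by (simp add: atMost_atLeast0 sum.atLeast_Suc_atMost)
  also have "(\<Sum>r = 1..M. real (M choose r)) = A + real M + 1"
    unfolding m(1) A_def by (simp add: binomial_symmetric[of "Suc m" "Suc (Suc m)"])
  finally have A: "A = 2 ^ M - real M - 2" by simp
  have "2 * A \<le> (\<Sum>r = 1..m. real (M choose r) * q r)"
    unfolding A_def sum_distrib_left using q m
    by (intro sum_mono) (simp add: mult.commute mult_left_mono)
  moreover have "(\<Sum>r = 1..M. real (M choose r) * q r)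
      = (\<Sum>r = 1..m. real (M choose r) * q r) + real (M choose (M - 1)) * q (M - 1) + q M"
    unfolding m(1) by simp
  moreover have "0 \<le> real (M choose (M - 1)) * q (M - 1)"
    using q0 by simp
  moreover have "2 * real M + 2 \<le> 2 ^ M"
    using M by (induction M rule: dec_induct) auto
  ultimately show ?thesis
    using A qM by linarith
qed

text \<open>
  The correlations of a single block are not bounded by the combined measure, which may vanish
  for \<open>r = M - 1\<close>.  The remaining orders compensate for this, except for \<open>M = 2\<close> and
  \<open>e 1 \<noteq> e 2\<close>, where the bound relies on
  the two sequences with longest run \<open>1\<close> lying in the same class.
\<close>

lemma X2_le_one_block:
  assumes M: "0 < M" and e: "e \<in> {1..M} \<rightarrow> {-1, 1}"
    and cover: "(\<Union>i\<in>{0..K}. P i) = {0..M}" and disj: "disjoint_family_on P {0..K}"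
  shows "X2 M 1 K P e
     \<le> (\<Sum>r = 1..M. real (M choose r) * real_of_int (combined_measure M e r))\<^sup>2"
proof -
  define q where "q r = real_of_int (combined_measure M e r)" for r
  define X where "X = (\<Sum>r = 1..M. real (M choose r) * q r)"
  have q0: "0 \<le> q r" if "1 \<le> r" for r
    using combined_measure_nonneg[OF e] that by (simp add: q_def)
  have qM: "q M = 1"
    using M by (simp add: q_def combined_measure_self)
  \<comment> \<open>A bound linear in \<open>X\<close> suffices, because
    \<open>X \<le> X\<^sup>2\<close> once \<open>1 \<le> X\<close>.\<close>
  have "X2 M 1 K P e \<le> X \<and> 1 \<le> X"
  proof (cases "M = 2 \<and> e 1 \<noteq> e 2")
    case True
    have X: "X = 2 * q 1 + 1"
      using True qM by (simp add: X_def numeral_2_eq_2)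
    have e12: "e 1 \<in> {-1, 1}" "e 2 \<in> {-1, 1}"
      using e True by (auto simp: Pi_iff)
    \<comment> \<open>The sequence and its negation are the two patterns with unequal entries.
      Together they form a set of size 2 inside one class, improving the bound from
      \<open>2 ^ 2 - 1 = 3\<close> to \<open>2 ^ 2 / 2 - 1 = 1\<close>.\<close>
    define g where "g = restrict e {1..2}"
    define h where "h = (\<lambda>i\<in>{1..2::nat}. - e i)"
    have vals: "g 1 = e 1" "g 2 = e 2" "h 1 = - e 1" "h 2 = - e 2"
      by (simp_all add: g_def h_def)
    have "longest_run 2 f = 1" if "f 1 = - f 2" "f 2 \<in> {-1, 1}" for f
      using that by (intro longest_run_2) auto
    moreover have "e 1 = - e 2"
      using e12 True by auto
    ultimately have "longest_run 2 e = 1" "longest_run 2 g = 1" "longest_run 2 h = 1"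
      using e12 vals by auto
    moreover have "g \<in> pm_seqs 2" "h \<in> pm_seqs 2"
      using e True by (auto simp: g_def h_def pm_seqs_def Pi_iff)
    moreover have "g \<noteq> h"
      using vals e12 by auto
    ultimately have "X2 M 1 K P e \<le> 2 ^ M / card {g, h} - 1"
      using True by (intro X2_one_block[OF e cover disj]) auto
    also have "\<dots> = 1"
      using \<open>g \<noteq> h\<close> True by simp
    finally show ?thesis
      using X q0[of 1] by simp
  next
    case False
    have "restrict e {1..M} \<in> pm_seqs M"
      using e by (auto simp: pm_seqs_def Pi_iff)
    moreover have "longest_run M (restrict e {1..M}) = longest_run M e"
      by (rule longest_run_cong) simp
    \<comment> \<open>Here the trivial bound \<open>2 ^ M - 1\<close> is enough: the class of
      \<open>e\<close> contains at least \<open>e\<close> itself.\<close>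
    ultimately have "X2 M 1 K P e \<le> 2 ^ M / card {restrict e {1..M}} - 1"
      by (intro X2_one_block[OF e cover disj]) auto
    moreover have "2 ^ M - 1 \<le> X"
    proof -
      consider "M = 1" | "M = 2" | "3 \<le> M" using M by linarith
      then show ?thesis
      proof cases
        case 1
        then show ?thesis using qM by (simp add: X_def)
      next
        case 2
        then have "2 \<le> q 1"
          using False combined_measure_1_ge_2[OF e] by (simp add: q_def)
        moreover have "X = 2 * q 1 + 1"
          using 2 qM by (simp add: X_def numeral_2_eq_2)
        ultimately show ?thesis using 2 by simp
      next
        case 3
        show ?thesis unfolding X_def
        proof (rule sum_choose_ge[OF 3])
          show "2 \<le> q r" if "1 \<le> r" "r + 2 \<le> M" for r
            using combined_measure_ge_2[OF e, of r] that by (simp add: q_def)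
        qed (use q0 qM 3 in auto)
      qed
    qed
    \<comment> \<open>Turns \<open>2 ^ M - 1 \<le> X\<close> into the second claim
      \<open>1 \<le> X\<close>.\<close>
    moreover have "(2::real) ^ 1 \<le> 2 ^ M"
      using M by (intro power_increasing) auto
    ultimately show ?thesis by simp
  qed
  then have "X2 M 1 K P e \<le> X\<^sup>2"
    using self_le_power[of X 2] by simp
  then show ?thesis by (simp add: X_def q_def)
qed

theorem theorem2:
  fixes N M t K :: nat and P :: "nat \<Rightarrow> nat set" and e :: "nat \<Rightarrow> int"
  assumes "0 < N" and "0 < M" and "0 < t" and "N = M * t"
    and "(\<Union>i\<in>{0..K}. P i) = {0..M}"
    and "\<And>i. i \<in> {0..K} \<Longrightarrow> P i \<noteq> {}"
    and "disjoint_family_on P {0..K}"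
    and "e \<in> {1..N} \<rightarrow> {-1, 1}"
  shows "X2 M t K P e
           \<le> real M / real N *
              (\<Sum>r = 1..M. real (M choose r) * real_of_int (combined_measure N e r))\<^sup>2"
proof (cases "t = 1")
  case True
  then show ?thesis
    using X2_le_one_block[of M e P K] assms by simp
next
  case False
  then have "X2 M t K P e
     \<le> (\<Sum>r = 1..M. real (M choose r) * real_of_int (combined_measure (M * t) e r))\<^sup>2 / real t"
    using assms by (intro X2_le_of_two_blocks) auto
  \<comment> \<open>As \<open>N = M * t\<close>, the factor \<open>M / N\<close> is
    \<open>1 / t\<close>.\<close>
  then show ?thesis
    using assms by simp
qed

end
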